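(* Let $\alpha\in(0,1)$, $N\ge 1$, and let $A$ be a real $N\times N$ matrix. Consider the system $$X_{t+1}=X_0+\sum_{j=0}^{t}\frac{\Gamma(t-j+\alpha)}{\Gamma(\alpha)\,\Gamma(t-j+1)}\,(A-I)X_j,\qquad t=0,1,2,\dots,$$ with $X_t\in\mathbb{R}^N$ and $I$ the $N\times N$ identity. The zero solution of this system is asymptotically stable if and only if every root $z$ of the characteristic equation $$\det\!\left(z(1-z^{-1})^{\alpha}I-(A-I)\right)=0$$ satisfies $|z|<1$ (equivalently, the characteristic equation has no root $z$ with $|z|\ge 1$).
   Context: $(1-z^{-1})^{\alpha}$ denotes the principal branch of the power, i.e. $\exp(\alpha\,\mathrm{Log}(1-z^{-1}))$ for $1-z^{-1}\notin(-\infty,0]$, with $0^\alpha=0$. The system above is the solution form of the Caputo-type fractional difference equation of order $\alpha$, $\Delta^\alpha X(t)=(A-I)X(t+\alpha-1)$, $X(0)=X_0$. Asymptotic stability of the zero solution means: it is (Lyapunov) stable and every solution starting sufficiently close to $0$ satisfies $X_t\to 0$ as $t\to\infty$. *)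

theory Defs
  imports "HOL-Analysis.Analysis"
begin

definition frac_coeff :: "real \<Rightarrow> nat \<Rightarrow> real" where
  "frac_coeff \<alpha> k = Gamma (real k + \<alpha>) / (Gamma \<alpha> * Gamma (real k + 1))"

definition is_frac_solution :: "real \<Rightarrow> real^'n^'n \<Rightarrow> (nat \<Rightarrow> real^'n) \<Rightarrow> bool" where
  "is_frac_solution \<alpha> A X \<longleftrightarrow>
     (\<forall>t. X (Suc t) = X 0 + (\<Sum>j\<le>t. frac_coeff \<alpha> (t - j) *\<^sub>R ((A - mat 1) *v X j)))"

definition zero_asymptotically_stable :: "real \<Rightarrow> real^'n^'n \<Rightarrow> bool" where
  "zero_asymptotically_stable \<alpha> A \<longleftrightarrow>
     (\<forall>\<epsilon>>0. \<exists>\<delta>>0. \<forall>X. is_frac_solution \<alpha> A X \<and> norm (X 0) < \<delta> \<longrightarrow> (\<forall>t. norm (X t) < \<epsilon>))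
   \<and> (\<exists>\<delta>>0. \<forall>X. is_frac_solution \<alpha> A X \<and> norm (X 0) < \<delta> \<longrightarrow> X \<longlonglongrightarrow> 0)"

definition cmat :: "real^'n^'n \<Rightarrow> complex^'n^'n" where
  "cmat A = (\<chi> i j. complex_of_real (A $ i $ j))"

text \<open>Characteristic function det(z (1 - 1/z)^alpha I - (A - I)), principal branch
  (complex powr uses the principal logarithm and 0 powr a = 0).\<close>
definition char_fun :: "real \<Rightarrow> real^'n^'n \<Rightarrow> complex \<Rightarrow> complex" where
  "char_fun \<alpha> A z = det (mat (z * (1 - 1 / z) powr complex_of_real \<alpha>) - cmat (A - mat 1))"

end

theory Submission
  imports Defs "HOL-Complex_Analysis.Complex_Analysis"
    "HOL-Computational_Algebra.Fundamental_Theorem_Algebra" "HOL-Real_Asymp.Real_Asymp"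
begin

text \<open>
  With \<open>w = 1 / z\<close> and \<open>B = A - I\<close>, the generating function \<open>F\<close> of a solution satisfies
  \<open>((1 - w) powr \<alpha> - w B) F(w) = (1 - w) powr (\<alpha> - 1) X\<^sub>0\<close>. The right-hand side has coefficients
  tending to 0, and so does its product with any absolutely summable power series. If the
  scalar symbol \<open>(1 - w) powr \<alpha> - \<mu> w\<close> of every eigenvalue \<open>\<mu>\<close> is zero-free on the closed disc,
  Wiener's lemma makes its reciprocal absolutely summable; peeling off the linear factors of a
  polynomial annihilating \<open>X\<^sub>0\<close> one at a time then shows that every solution tends to 0.
  Conversely, a zero \<open>w\<^sub>0\<close> of such a symbol in the closed disc prevents the scalar
  solution along an eigenvector from tending to 0: that solution is constant if \<open>w\<^sub>0 = 1\<close>, and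
  otherwise its generating function would be \<open>o(1 / (1 - r))\<close> at \<open>r w\<^sub>0\<close> as \<open>r\<close> tends to 1, whereas the
  symbol is \<open>O(1 - r)\<close> there and their product has a nonzero limit.
\<close>

section \<open>Wiener's lemma for absolutely summable power series\<close>

definition fps_l1 :: "complex fps \<Rightarrow> bool" where
  "fps_l1 f \<longleftrightarrow> summable (\<lambda>k. norm (fps_nth f k))"

definition fps_l1_norm :: "complex fps \<Rightarrow> real" where
  "fps_l1_norm f = (\<Sum>k. norm (fps_nth f k))"

lemma fps_l1_norm_nonneg: "fps_l1 f \<Longrightarrow> 0 \<le> fps_l1_norm f"
  unfolding fps_l1_def fps_l1_norm_def by (intro suminf_nonneg) auto

lemma fps_l1_if_eventually_0:
  assumes "\<And>k. k \<ge> K \<Longrightarrow> fps_nth f k = 0"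
  shows "fps_l1 f"
  unfolding fps_l1_def using assms by (intro summable_finite[of "{..<K}"]) (auto simp: not_less)

lemma fps_l1_1: "fps_l1 1" and fps_l1_X: "fps_l1 fps_X"
  by (rule fps_l1_if_eventually_0[of 2], simp)+

lemma fps_l1_cmult: "fps_l1 f \<Longrightarrow> fps_l1 (fps_const c * f)"
  unfolding fps_l1_def by (simp add: norm_mult summable_mult)

lemma fps_l1_add: "fps_l1 f \<Longrightarrow> fps_l1 g \<Longrightarrow> fps_l1 (f + g)"
  unfolding fps_l1_def
  by (rule summable_comparison_test'[of "\<lambda>k. norm (fps_nth f k) + norm (fps_nth g k)"])
     (auto intro: norm_triangle_ineq summable_add)

lemma fps_l1_diff: "fps_l1 f \<Longrightarrow> fps_l1 g \<Longrightarrow> fps_l1 (f - g)"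
  using fps_l1_add[of f "fps_const (-1) * g"] fps_l1_cmult[of g "-1"]
  by (simp flip: fps_const_neg)

lemma fps_l1_sum: "(\<And>i. i \<in> I \<Longrightarrow> fps_l1 (f i)) \<Longrightarrow> fps_l1 (sum f I)"
  by (induction I rule: infinite_finite_induct)
     (auto intro: fps_l1_add fps_l1_if_eventually_0[of 0])

text \<open>The coefficients of \<open>f * g\<close> are dominated by the Cauchy product of the two
  series of absolute values, which sums to the product of the norms.\<close>

lemma
  assumes f: "fps_l1 f" and g: "fps_l1 g"
  shows fps_l1_mult: "fps_l1 (f * g)"
    and fps_l1_norm_mult: "fps_l1_norm (f * g) \<le> fps_l1_norm f * fps_l1_norm g"
proof -
  have le: "norm (fps_nth (f * g) k) \<le> (\<Sum>i\<le>k. norm (fps_nth f i) * norm (fps_nth g (k - i)))" for k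
    unfolding fps_mult_nth atLeast0AtMost
    by (rule order_trans[OF norm_sum]) (simp add: norm_mult)
  have s: "(\<lambda>k. \<Sum>i\<le>k. norm (fps_nth f i) * norm (fps_nth g (k - i))) sums
      (fps_l1_norm f * fps_l1_norm g)"
    using f g unfolding fps_l1_norm_def fps_l1_def by (intro Cauchy_product_sums) auto
  show l1: "fps_l1 (f * g)"
    unfolding fps_l1_def
    by (rule summable_comparison_test'[OF sums_summable[OF s]]) (use le in auto)
  show "fps_l1_norm (f * g) \<le> fps_l1_norm f * fps_l1_norm g"
    unfolding sums_unique[OF s] fps_l1_norm_def[of "f * g"]
    by (rule suminf_le[OF le]) (use l1 s in \<open>auto simp: fps_l1_def sums_iff\<close>)
qed

lemma
  assumes f: "fps_l1 f"
  shows fps_l1_power: "fps_l1 (f ^ n)"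
    and fps_l1_norm_power: "fps_l1_norm (f ^ n) \<le> fps_l1_norm f ^ n"
proof (induction n)
  case 0
  { case 1 show ?case using fps_l1_1 by simp }
  { case 2
    have "(\<Sum>k. norm (fps_nth (1 :: complex fps) k)) = (\<Sum>k\<in>{0}. norm (fps_nth (1 :: complex fps) k))"
      by (rule suminf_finite) auto
    then show ?case by (simp add: fps_l1_norm_def) }
next
  case (Suc n)
  { case 1 show ?case using Suc fps_l1_mult[OF f] by simp }
  { case 2
    have "fps_l1_norm (f ^ Suc n) \<le> fps_l1_norm f * fps_l1_norm (f ^ n)"
      using fps_l1_norm_mult[OF f Suc(1)] by simp
    also have "\<dots> \<le> fps_l1_norm f * fps_l1_norm f ^ n"
      by (intro mult_left_mono Suc fps_l1_norm_nonneg f)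
    finally show ?case by simp }
qed

section \<open>Evaluation on the closed unit disc\<close>

lemma
  assumes f: "fps_l1 f" and w: "norm w \<le> 1"
  shows fps_l1_summable: "summable (\<lambda>n. norm (fps_nth f n * w ^ n))"
    and fps_l1_sums: "(\<lambda>n. fps_nth f n * w ^ n) sums eval_fps f w"
    and norm_eval_fps_le: "norm (eval_fps f w) \<le> fps_l1_norm f"
proof -
  have le: "norm (fps_nth f n * w ^ n) \<le> norm (fps_nth f n)" for n
    using power_le_one[of "norm w" n] w by (auto simp: norm_mult norm_power intro: mult_left_le)
  show s: "summable (\<lambda>n. norm (fps_nth f n * w ^ n))"
    by (rule summable_comparison_test'[of "\<lambda>n. norm (fps_nth f n)"]) (use f le in \<open>auto simp: fps_l1_def\<close>)
  show "(\<lambda>n. fps_nth f n * w ^ n) sums eval_fps f w"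
    using summable_norm_cancel[OF s] unfolding eval_fps_def by (simp add: summable_sums)
  show "norm (eval_fps f w) \<le> fps_l1_norm f"
    unfolding eval_fps_def fps_l1_norm_def
    by (rule order_trans[OF summable_norm[OF s] suminf_le[OF le s]]) (use f in \<open>simp add: fps_l1_def\<close>)
qed

lemma eval_fps_l1_diff:
  assumes "fps_l1 f" "fps_l1 g" "norm w \<le> 1"
  shows "eval_fps (f - g) w = eval_fps f w - eval_fps g w"
  using sums_diff[OF fps_l1_sums[OF assms(1,3)] fps_l1_sums[OF assms(2,3)]]
    fps_l1_sums[OF fps_l1_diff[OF assms(1,2)] assms(3)]
  by (simp add: left_diff_distrib sums_iff)

lemma continuous_on_eval_fps_l1:
  assumes f: "fps_l1 f"
  shows "continuous_on (cball 0 1) (eval_fps f)"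
proof -
  have "uniform_limit (cball 0 1) (\<lambda>n w. \<Sum>i<n. fps_nth f i * w ^ i) (eval_fps f) sequentially"
    unfolding eval_fps_def
  proof (rule Weierstrass_m_test)
    show "norm (fps_nth f n * w ^ n) \<le> norm (fps_nth f n)" if "w \<in> cball 0 1" for n w
      using power_le_one[of "norm w" n] that
      by (auto simp: norm_mult norm_power intro: mult_left_le)
  qed (use f in \<open>simp add: fps_l1_def\<close>)
  then show ?thesis
    by (rule uniform_limit_theorem[rotated]) (auto intro!: always_eventually continuous_intros)
qed

text \<open>With \<open>g = inverse f\<close> the hypothesis becomes \<open>g = s + e * g\<close>. A
  partial sum \<open>G\<close> of the norms of the coefficients of \<open>g\<close> thus satisfies
  \<open>G \<le> ?s + ?e * G\<close>, and \<open>?e < 1\<close> lets the last term be absorbed on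
  the left.\<close>

lemma fps_l1_inverse_if_approx_inverse:
  assumes s: "fps_l1 s" and e: "fps_l1 e" and fs: "f * s = 1 - e" and e1: "fps_l1_norm e < 1"
    and f0: "fps_nth f 0 \<noteq> 0"
  shows "fps_l1 (inverse f)"
proof -
  define g where "g = inverse f"
  have gf: "g * f = 1" using f0 unfolding g_def by (rule inverse_mult_eq_1)
  have "g * (f * s) = g - g * e" using fs by (metis mult.right_neutral right_diff_distrib)
  moreover have "g * (f * s) = s" using gf by (metis mult.assoc mult_1)
  ultimately have "s = g - g * e" by simp
  then have g: "g = s + e * g" by (metis diff_add_cancel mult.commute)
  let ?e = "fps_l1_norm e" and ?s = "fps_l1_norm s"
  have bound: "(\<Sum>k<K. norm (fps_nth g k)) \<le> ?s / (1 - ?e)" for K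
  proof -
    define G where "G = (\<Sum>k<K. norm (fps_nth g k))"
    \<comment> \<open>Truncation makes the norm finite before \<open>g\<close> is known to be
      summable. Coefficients of \<open>e * g\<close> below \<open>K\<close> depend only on
      coefficients of \<open>g\<close> below \<open>K\<close>, so they are unchanged.\<close>
    define g' where "g' = Abs_fps (\<lambda>k. if k < K then fps_nth g k else 0)"
    have l1g: "fps_l1 g'" by (rule fps_l1_if_eventually_0[of K]) (simp add: g'_def)
    have ng: "fps_l1_norm g' = G"
      unfolding fps_l1_norm_def G_def
      by (subst suminf_finite[of "{..<K}"]) (auto simp: g'_def)
    have eq: "fps_nth (e * g) k = fps_nth (e * g') k" if "k < K" for k
      unfolding fps_mult_nth using that by (intro sum.cong) (auto simp: g'_def)
    have part: "(\<Sum>k<K. norm (fps_nth h k)) \<le> fps_l1_norm h" if "fps_l1 h" for h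
      using that unfolding fps_l1_def fps_l1_norm_def by (intro sum_le_suminf) auto
    have "G \<le> (\<Sum>k<K. norm (fps_nth s k) + norm (fps_nth (e * g') k))"
      unfolding G_def
    proof (rule sum_mono)
      fix k assume "k \<in> {..<K}"
      then have "fps_nth g k = fps_nth s k + fps_nth (e * g') k"
        using eq[of k] by (subst g) simp
      then show "norm (fps_nth g k) \<le> norm (fps_nth s k) + norm (fps_nth (e * g') k)"
        by (metis norm_triangle_ineq)
    qed
    also have "\<dots> \<le> ?s + fps_l1_norm (e * g')"
      unfolding sum.distrib by (intro add_mono part s fps_l1_mult e l1g)
    also have "\<dots> \<le> ?s + ?e * G"
      using fps_l1_norm_mult[OF e l1g] ng by simp
    finally show ?thesis using e1 unfolding G_def[symmetric] by (simp add: field_simps)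
  qed
  show ?thesis
    unfolding fps_l1_def g_def[symmetric]
    by (rule bounded_imp_summable) (use bound[of "Suc _"] in \<open>auto simp only: lessThan_Suc_atMost norm_ge_zero\<close>)
qed

text \<open>Cauchy's estimate on the circle of radius \<open>R\<close> gives a geometric majorant
  for the coefficients. The factor \<open>R / (R - 1)\<close> does not depend on \<open>M\<close>,
  so the norm grows no faster than \<open>(1 / d) ^ M\<close>.\<close>

lemma fps_l1_norm_inverse_polynomial_power:
  fixes p :: "complex poly"
  assumes R: "1 < R" and d: "0 < d" and p: "\<And>w. norm w \<le> R \<Longrightarrow> d \<le> norm (poly p w)"
  shows "fps_l1 (inverse (fps_of_poly p) ^ M) \<and>
    fps_l1_norm (inverse (fps_of_poly p) ^ M) \<le> (1 / d) ^ M * (R / (R - 1))"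
proof -
  define q where "q = (\<lambda>w. inverse (poly p w) ^ M)"
  have nz: "poly p w \<noteq> 0" if "norm w \<le> R" for w
    using p[OF that] d by auto
  have p0: "fps_nth (fps_of_poly p) 0 \<noteq> 0"
    using nz[of 0] R by (simp add: poly_0_coeff_0)
  have "poly p has_fps_expansion fps_of_poly p"
    using eval_fps_has_fps_expansion[of "fps_of_poly p"]
    by (simp add: eval_fps_of_poly[abs_def])
  then have exp: "q has_fps_expansion inverse (fps_of_poly p) ^ M"
    unfolding q_def by (intro has_fps_expansion_power has_fps_expansion_inverse p0)
  have hol: "q holomorphic_on cball 0 R"
    unfolding q_def using nz by (intro holomorphic_intros) auto
  have bound: "norm (fps_nth (inverse (fps_of_poly p) ^ M) n) \<le> (1 / d) ^ M * (1 / R) ^ n" for n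
  proof -
    have "norm ((deriv ^^ n) q 0) \<le> fact n * (1 / d) ^ M / R ^ n"
    proof (rule Cauchy_inequality)
      show "norm (q x) \<le> (1 / d) ^ M" if "norm (0 - x) = R" for x
        unfolding q_def norm_power norm_inverse
        using p[of x] that d R le_imp_inverse_le[of d "norm (poly p x)"]
        by (intro power_mono) (auto simp: inverse_eq_divide)
    qed (use hol R in \<open>auto intro: holomorphic_on_subset holomorphic_on_imp_continuous_on\<close>)
    then show ?thesis
      unfolding fps_nth_fps_expansion[OF exp]
      by (simp add: norm_divide field_simps power_divide)
  qed
  have geo: "(\<lambda>n. (1 / d) ^ M * (1 / R) ^ n) sums ((1 / d) ^ M * (R / (R - 1)))"
  proof -
    have "1 / (1 - 1 / R) = R / (R - 1)" using R by (simp add: field_simps)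
    then show ?thesis using sums_mult[OF geometric_sums[of "1 / R"], of "(1 / d) ^ M"] R by simp
  qed
  have "fps_l1 (inverse (fps_of_poly p) ^ M)"
    unfolding fps_l1_def
    by (rule summable_comparison_test'[OF sums_summable[OF geo]]) (use bound in auto)
  moreover from this have "fps_l1_norm (inverse (fps_of_poly p) ^ M) \<le> (1 / d) ^ M * (R / (R - 1))"
    unfolding sums_unique[OF geo] fps_l1_norm_def fps_l1_def
    by (intro suminf_le bound sums_summable[OF geo])
  ultimately show ?thesis ..
qed

text \<open>A point slightly outside the unit disc is compared with its radial projection onto the
  unit circle; uniform continuity makes the loss less than \<open>d - c\<close>.\<close>

lemma polynomial_lower_bound_larger_disc:
  fixes p :: "complex poly"
  assumes "c < d" and p: "\<And>w. norm w \<le> 1 \<Longrightarrow> d \<le> norm (poly p w)"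
  obtains R where "1 < R" "\<And>w. norm w \<le> R \<Longrightarrow> c \<le> norm (poly p w)"
proof -
  have "uniformly_continuous_on (cball 0 2) (poly p)"
    by (intro compact_uniformly_continuous continuous_intros) auto
  moreover have "0 < d - c" using assms by simp
  ultimately obtain \<rho> where \<rho>: "0 < \<rho>"
    "\<And>w w'. w \<in> cball 0 2 \<Longrightarrow> w' \<in> cball 0 2 \<Longrightarrow> dist w' w < \<rho> \<Longrightarrow> dist (poly p w') (poly p w) < d - c"
    unfolding uniformly_continuous_on_def by metis
  \<comment> \<open>The cap 2 stays inside the disc of uniform continuity, and
    \<open>\<rho> / 2\<close> keeps the distance to the unit circle strictly below
    \<open>\<rho>\<close>.\<close>
  define R where "R = min 2 (1 + \<rho> / 2)"
  show thesis
  proof (rule that[of R])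
    show "1 < R" using \<rho> by (simp add: R_def)
    show "c \<le> norm (poly p w)" if w: "norm w \<le> R" for w
    proof (cases "norm w \<le> 1")
      case True then show ?thesis using p[of w] assms(1) by linarith
    next
      case False
      then have w0: "w \<noteq> 0" by auto
      define u where "u = w / of_real (norm w)"
      have u: "norm u = 1" using w0 by (simp add: u_def norm_divide)
      have "w - u = of_real (norm w - 1) * u" using w0 by (simp add: u_def field_simps)
      then have "norm (w - u) = \<bar>norm w - 1\<bar>"
        using u by (metis mult.right_neutral norm_mult norm_of_real)
      then have "dist u w < \<rho>" using False w \<rho>(1) by (simp add: dist_norm R_def norm_minus_commute)
      then have "norm (poly p u - poly p w) < d - c"
        using \<rho>(2)[of w u] u w by (simp add: R_def dist_norm)
      moreover have "d \<le> norm (poly p u)" using p u by simp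
      ultimately show ?thesis using norm_triangle_ineq2[of "poly p u" "poly p w"] by linarith
    qed
  qed
qed

text \<open>Newman's argument: write \<open>f = p - h\<close> with \<open>p\<close> a truncation of \<open>f\<close> and \<open>h\<close> small in norm.
  With \<open>q = 1 / p\<close>, a partial sum of the geometric series \<open>q (1 + h q + (h q)\<^sup>2 + \<dots>)\<close> inverts
  \<open>f\<close> up to the error \<open>(h q) ^ M\<close>, and Cauchy's estimates bound the norm of \<open>q ^ M\<close>.\<close>

theorem wiener_lemma_disc:
  assumes f: "fps_l1 f" and nz: "\<And>w. norm w \<le> 1 \<Longrightarrow> eval_fps f w \<noteq> 0"
  shows "fps_l1 (inverse f)"
proof -
  have "\<exists>d>0. \<forall>w\<in>cball 0 1. d \<le> norm (eval_fps f w)"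
  proof -
    have "continuous_on (cball 0 1) (\<lambda>w. norm (eval_fps f w))"
      by (intro continuous_intros continuous_on_eval_fps_l1 f)
    then obtain w0 where "w0 \<in> cball 0 1" "\<And>w. w \<in> cball 0 1 \<Longrightarrow> norm (eval_fps f w0) \<le> norm (eval_fps f w)"
      using continuous_attains_inf[of "cball 0 1 :: complex set"] by (metis compact_cball cball_eq_empty not_one_less_zero)
    then show ?thesis using nz[of w0] by (intro exI[of _ "norm (eval_fps f w0)"]) auto
  qed
  \<comment> \<open>The three portions of \<open>d\<close> are spent in turn: subtracting
    \<open>h\<close> leaves \<open>2 * d\<close> for \<open>p\<close> on the unit disc, enlarging
    the disc leaves \<open>d\<close>, and the norm of \<open>h\<close> stays below this last
    \<open>d\<close>.\<close>
  then obtain d where d: "0 < d" "\<And>w. norm w \<le> 1 \<Longrightarrow> 3 * d \<le> norm (eval_fps f w)"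
    by (metis dist_0_norm divide_pos_pos mem_cball mult.commute nonzero_eq_divide_eq zero_less_numeral zero_neq_numeral)
  have "(\<lambda>K. (\<Sum>k. norm (fps_nth f (k + K)))) \<longlonglongrightarrow> 0"
    using f unfolding fps_l1_def by (rule suminf_exist_split2)
  then have "eventually (\<lambda>K. (\<Sum>k. norm (fps_nth f (k + K))) < d) sequentially"
    using d(1) by (rule order_tendstoD)
  then obtain K where K: "(\<Sum>k. norm (fps_nth f (k + K))) < d"
    by (auto simp: eventually_sequentially)
  define p where "p = poly_of_list (map (fps_nth f) [0..<K])"
  define h where "h = fps_of_poly p - f"
  have pn: "coeff p k = (if k < K then fps_nth f k else 0)" for k
    by (simp add: p_def nth_default_def)
  have l1p: "fps_l1 (fps_of_poly p)" by (rule fps_l1_if_eventually_0[of K]) (simp add: pn)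
  have l1h: "fps_l1 h" unfolding h_def by (intro fps_l1_diff l1p f)
  have h_small: "fps_l1_norm h < d"
  proof -
    have "fps_l1_norm h = (\<Sum>k. norm (fps_nth h (k + K))) + (\<Sum>k<K. norm (fps_nth h k))"
      using l1h unfolding fps_l1_norm_def fps_l1_def by (rule suminf_split_initial_segment)
    also have "(\<Sum>k<K. norm (fps_nth h k)) = 0" by (simp add: h_def pn)
    finally show ?thesis using K by (simp add: h_def pn)
  qed
  have p_large: "2 * d \<le> norm (poly p w)" if "norm w \<le> 1" for w
  proof -
    have "eval_fps f w = poly p w - eval_fps h w"
      using eval_fps_l1_diff[OF l1p f that] by (simp add: h_def)
    then have "norm (eval_fps f w) \<le> norm (poly p w) + norm (eval_fps h w)"
      by (metis norm_triangle_ineq4)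
    then show ?thesis
      using d(2)[OF that] h_small norm_eval_fps_le[OF l1h that] by linarith
  qed
  obtain c where c: "fps_l1_norm h < c" "c < d" using dense[OF h_small] by blast
  have c0: "0 < c" using c fps_l1_norm_nonneg[OF l1h] by simp
  obtain R where R: "1 < R" "\<And>w. norm w \<le> R \<Longrightarrow> d \<le> norm (poly p w)"
    using polynomial_lower_bound_larger_disc[OF _ p_large, of d] d(1) by auto
  define q where "q = inverse (fps_of_poly p)"
  have qM: "fps_l1 (q ^ M)" "fps_l1_norm (q ^ M) \<le> (1 / d) ^ M * (R / (R - 1))" for M
    using fps_l1_norm_inverse_polynomial_power[OF R(1) d(1) R(2), of M] unfolding q_def by auto
  have pq: "fps_of_poly p * q = 1"
    unfolding q_def using p_large[of 0] d(1)
    by (intro inverse_mult_eq_1') (auto simp: poly_0_coeff_0)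
  \<comment> \<open>This is the bound for the norm of the error \<open>(h * q) ^ M\<close>. As
    \<open>R\<close> is fixed before \<open>M\<close>, the decay of \<open>(c / d) ^ M\<close>
    wins.\<close>
  have "(\<lambda>M. (c / d) ^ M * (R / (R - 1))) \<longlonglongrightarrow> 0 * (R / (R - 1))"
    using c c0 d(1) by (intro tendsto_intros LIMSEQ_power_zero) auto
  then have "eventually (\<lambda>M. (c / d) ^ M * (R / (R - 1)) < 1) sequentially"
    by (intro order_tendstoD) auto
  then obtain M where M: "(c / d) ^ M * (R / (R - 1)) < 1"
    by (auto simp: eventually_sequentially)
  show ?thesis
  proof (rule fps_l1_inverse_if_approx_inverse)
    show "fps_l1 (q * (\<Sum>n<M. (h * q) ^ n))"
      using qM(1)[of 1] by (intro fps_l1_mult fps_l1_sum fps_l1_power l1h) auto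
    show "fps_l1 ((h * q) ^ M)"
      using qM(1)[of 1] by (intro fps_l1_mult fps_l1_power l1h) auto
    have "f * q = 1 - h * q" using pq by (simp add: h_def algebra_simps)
    then show "f * (q * (\<Sum>n<M. (h * q) ^ n)) = 1 - (h * q) ^ M"
      by (metis mult.assoc one_diff_power_eq)
    \<comment> \<open>The powers of \<open>h\<close> and \<open>q\<close> are estimated separately:
      the bound on the norm of \<open>q\<close> carries the factor \<open>R / (R - 1)\<close>, which
      must enter once and not \<open>M\<close> times.\<close>
    have "fps_l1_norm ((h * q) ^ M) \<le> fps_l1_norm (h ^ M) * fps_l1_norm (q ^ M)"
      unfolding power_mult_distrib by (intro fps_l1_norm_mult fps_l1_power l1h qM)
    also have "\<dots> \<le> c ^ M * ((1 / d) ^ M * (R / (R - 1)))"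
      using c c0 fps_l1_norm_power[OF l1h, of M] fps_l1_norm_nonneg[OF l1h] qM
      by (intro mult_mono fps_l1_norm_nonneg) (auto intro: order_trans[OF _ power_mono[of "fps_l1_norm h" c M]])
    finally show "fps_l1_norm ((h * q) ^ M) < 1"
      using M by (simp add: power_divide field_simps)
    show "fps_nth f 0 \<noteq> 0"
      using nz[of 0] by (simp add: eval_fps_at_0)
  qed
qed

section \<open>The binomial series\<close>

text \<open>The power series of \<open>(1 - w) powr a\<close>.\<close>
definition pow_series :: "real \<Rightarrow> complex fps" where
  "pow_series a = Abs_fps (\<lambda>k. of_real (pochhammer (- a) k / fact k))"

lemma pow_series_nth:
  "fps_nth (pow_series a) k = (of_real a gchoose k) * (- 1) ^ k"
  by (simp add: pow_series_def gbinomial_pochhammer pochhammer_of_real flip: of_real_minus)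

lemma pow_series_nth_0: "fps_nth (pow_series a) 0 = 1"
  by (simp add: pow_series_def)

text \<open>The exponent law is the Chu-Vandermonde convolution, a formal identity for all real
  exponents, so no convergence is involved.\<close>

lemma pow_series_mult: "pow_series a * pow_series b = pow_series (a + b)"
proof (rule fps_ext)
  fix n
  have "fps_nth (pow_series a * pow_series b) n =
      (\<Sum>i=0..n. (of_real a gchoose i) * (of_real b gchoose (n - i)) * (- 1) ^ n)"
    unfolding fps_mult_nth pow_series_nth
  proof (rule sum.cong)
    fix i assume "i \<in> {0..n}"
    then have "(- 1 :: complex) ^ n = (- 1) ^ i * (- 1) ^ (n - i)" by (simp flip: power_add)
    then show "(complex_of_real a gchoose i) * (- 1) ^ i * ((of_real b gchoose (n - i)) * (- 1) ^ (n - i)) =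
        (of_real a gchoose i) * (of_real b gchoose (n - i)) * (- 1) ^ n"
      by (simp add: mult_ac)
  qed simp
  then show "fps_nth (pow_series a * pow_series b) n = fps_nth (pow_series (a + b)) n"
    by (simp add: pow_series_nth gbinomial_Vandermonde flip: sum_distrib_right)
qed

lemma pow_series_0: "pow_series 0 = 1"
  by (rule fps_ext) (simp add: pow_series_def pochhammer_0_left)

lemma pow_series_minus_1_nth: "fps_nth (pow_series (- 1)) n = 1"
  by (simp add: pow_series_def flip: pochhammer_fact)

text \<open>Convolution with the memory kernel of the system thereby becomes multiplication by the
  series of \<open>(1 - w) powr (- \<alpha>)\<close>.\<close>

lemma frac_coeff_pow_series:
  assumes "0 < \<alpha>"
  shows "of_real (frac_coeff \<alpha> k) = fps_nth (pow_series (- \<alpha>)) k"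
proof -
  have "pochhammer \<alpha> k = Gamma (\<alpha> + of_nat k) / Gamma \<alpha>"
    using assms by (intro pochhammer_Gamma) (auto elim!: nonpos_Ints_cases)
  moreover have "Gamma (real k + 1) = fact k" using Gamma_fact[of k, where ?'a = real] by (simp add: add.commute)
  ultimately show ?thesis by (simp add: frac_coeff_def pow_series_def add.commute)
qed

text \<open>All coefficients after the leading 1 are nonpositive, while the partial sums have a
  nonnegative closed form. Hence the absolute values sum to at most 2.\<close>

lemma fps_l1_pow_series:
  assumes "0 < a" "a < 1"
  shows "fps_l1 (pow_series a)"
proof -
  define c where "c k = (a gchoose k) * (- 1) ^ k" for k
  have c: "c k = pochhammer (- a) k / fact k" for k
    by (simp add: c_def gbinomial_pochhammer flip: power_mult_distrib)
  have neg: "c (Suc k) \<le> 0" for k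
    using assms by (simp add: c pochhammer_rec divide_nonpos_pos mult_nonpos_nonneg pochhammer_nonneg)
  have sums: "(\<Sum>k\<le>m. c k) \<ge> 0" for m
    unfolding c_def gbinomial_sum_lower_neg
    using assms by (simp add: gbinomial_pochhammer pochhammer_nonneg flip: power_mult_distrib mult.assoc)
  have abs: "\<bar>c k\<bar> = - c k + (if k = 0 then 2 else 0)" for k
  proof (cases k)
    case 0 then show ?thesis by (simp add: c_def)
  next
    case (Suc j) then show ?thesis using neg[of j] by simp
  qed
  have "(\<Sum>k\<le>m. \<bar>c k\<bar>) \<le> 2" for m
    using sums[of m] by (simp add: abs sum_subtractf)
  then have "summable (\<lambda>k. \<bar>c k\<bar>)" by (intro bounded_imp_summable) auto
  then show ?thesis by (simp add: fps_l1_def pow_series_def c norm_divide)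
qed

text \<open>By the asymptotics of binomial coefficients, the coefficients multiplied by
  \<open>n powr a\<close> converge to \<open>1 / Gamma (1 - a)\<close>; the factor
  \<open>n powr (- a)\<close> then forces them to 0.\<close>

lemma pow_series_nth_tendsto_0:
  assumes "0 < a"
  shows "fps_nth (pow_series (a - 1)) \<longlonglongrightarrow> 0"
proof -
  define z where "z = complex_of_real (a - 1)"
  have "((\<lambda>n. (z gchoose n) / ((- 1) ^ n / exp ((z + 1) * of_real (ln (real n)))) *
      exp (- (z + 1) * of_real (ln (real n)))) \<longlongrightarrow> inverse (Gamma (- z)) * 0) sequentially"
  proof (intro tendsto_mult gbinomial_asymptotic)
    have "(\<lambda>n. exp (- a * ln (real n))) \<longlonglongrightarrow> 0"
      using assms by real_asymp
    then have "(\<lambda>n. of_real (exp (- a * ln (real n)))) \<longlonglongrightarrow> (of_real 0 :: complex)"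
      by (rule tendsto_of_real)
    then show "(\<lambda>n. exp (- (z + 1) * of_real (ln (real n)))) \<longlonglongrightarrow> 0"
      by (simp add: z_def flip: exp_of_real)
  qed
  moreover have "(z gchoose n) / ((- 1) ^ n / exp ((z + 1) * of_real (ln (real n)))) *
      exp (- (z + 1) * of_real (ln (real n))) = fps_nth (pow_series (a - 1)) n" for n
    by (cases "even n") (simp_all add: pow_series_nth z_def exp_minus)
  ultimately show ?thesis by simp
qed

lemma pow_series_sums:
  assumes "norm w < 1"
  shows "(\<lambda>n. fps_nth (pow_series a) n * w ^ n) sums ((1 - w) powr of_real a)"
proof -
  have "(of_real a gchoose n) * (- w) ^ n = fps_nth (pow_series a) n * w ^ n" for n
    by (simp add: pow_series_nth power_minus[of w])
  then show ?thesis using gen_binomial_complex[of "- w" "of_real a"] assms by simp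
qed

text \<open>The binomial theorem holds inside the disc and is carried to the boundary along a
  radius. At \<open>w = 1\<close> continuity of the power at 0 uses \<open>a > 0\<close>; elsewhere
  \<open>1 - w\<close> has positive real part and avoids the branch cut.\<close>

lemma eval_pow_series:
  assumes a: "0 < a" "a < 1" and w: "norm w \<le> 1"
  shows "eval_fps (pow_series a) w = (1 - w) powr of_real a"
proof (rule tendsto_unique)
  \<comment> \<open>With \<open>Suc n\<close> every radius lies in \<open>[0, 1)\<close>; plain
    \<open>n\<close> would give radius 1 at \<open>n = 0\<close>, since division by 0 yields
    0.\<close>
  have r: "filterlim (\<lambda>n. 1 - 1 / real (Suc n)) (nhds 1) sequentially" by real_asymp
  have lim: "(\<lambda>n. of_real (1 - 1 / real (Suc n)) * w) \<longlonglongrightarrow> w"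
    using tendsto_mult[OF tendsto_of_real[OF r] tendsto_const[of w]] by simp
  have small: "norm (of_real (1 - 1 / real (Suc n)) * w) < 1" for n
  proof -
    have "\<bar>1 - 1 / real (Suc n)\<bar> < 1" by (simp add: abs_if field_simps)
    then show ?thesis using w unfolding norm_mult norm_of_real
      by (metis abs_ge_zero mult.right_neutral mult_left_mono order_le_less_trans)
  qed
  show "(\<lambda>n. eval_fps (pow_series a) (of_real (1 - 1 / real (Suc n)) * w)) \<longlonglongrightarrow> eval_fps (pow_series a) w"
    using continuous_on_tendsto_compose[OF continuous_on_eval_fps_l1[OF fps_l1_pow_series[OF a]] lim]
      w small by (auto intro!: always_eventually less_imp_le)
  have "(\<lambda>n. (1 - of_real (1 - 1 / real (Suc n)) * w) powr of_real a) \<longlonglongrightarrow> (1 - w) powr of_real a"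
  proof (cases "w = 1")
    case True
    then show ?thesis using a tendsto_diff[OF tendsto_const[of 1] lim]
      by (auto intro!: tendsto_powr_complex_0)
  next
    case False
    then have "1 - w \<notin> \<real>\<^sub>\<le>\<^sub>0"
      using w abs_Re_le_cmod[of w] by (auto simp: complex_nonpos_Reals_iff complex_eq_iff)
    then show ?thesis by (intro tendsto_powr_complex tendsto_intros lim)
  qed
  moreover have "eval_fps (pow_series a) (of_real (1 - 1 / real (Suc n)) * w) =
      (1 - of_real (1 - 1 / real (Suc n)) * w) powr of_real a" for n
    using pow_series_sums[OF small[of n]] by (simp add: eval_fps_def sums_iff)
  ultimately show "(\<lambda>n. eval_fps (pow_series a) (of_real (1 - 1 / real (Suc n)) * w)) \<longlonglongrightarrow> (1 - w) powr of_real a"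
    by simp
qed simp

section \<open>Decay of solutions\<close>

text \<open>Dominated convergence for series: each term of the convolution tends to 0 for fixed
  \<open>k\<close> and is bounded by the summable \<open>norm (fps_nth g k) * H\<close>.\<close>

lemma fps_l1_mult_tendsto_0:
  assumes g: "fps_l1 g" and h: "fps_nth h \<longlonglongrightarrow> 0"
  shows "fps_nth (g * h) \<longlonglongrightarrow> 0"
proof -
  obtain H where H: "\<And>n. norm (fps_nth h n) \<le> H"
    using convergent_imp_Bseq[OF convergentI[OF h]] by (auto simp: Bseq_def)
  \<comment> \<open>Extension by 0 for \<open>k > n\<close> turns the finite convolutions into
    series over one fixed index set.\<close>
  define a where "a k n = fps_nth g k * (if k \<le> n then fps_nth h (n - k) else 0)" for k n
  have "(\<lambda>n. \<Sum>k. a k n) \<longlonglongrightarrow> (\<Sum>k. 0)"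
  proof (rule tannerys_theorem[THEN conjunct2, THEN conjunct2])
    show "(\<lambda>n. a k n) \<longlonglongrightarrow> 0" for k
    proof (rule LIMSEQ_offset[where k = k])
      show "(\<lambda>n. a k (n + k)) \<longlonglongrightarrow> 0"
        unfolding a_def using tendsto_mult_right_zero[OF h] by simp
    qed
    have "norm (a k n) \<le> norm (fps_nth g k) * H" for k n
      unfolding a_def norm_mult using H order_trans[OF norm_ge_zero H] by (intro mult_left_mono) auto
    then show "eventually (\<lambda>(k, n). norm (a k n) \<le> norm (fps_nth g k) * H) (sequentially \<times>\<^sub>F sequentially)"
      by (intro always_eventually) auto
    show "summable (\<lambda>k. norm (fps_nth g k) * H)"
      using g unfolding fps_l1_def by (rule summable_mult2)
  qed simp
  moreover have "(\<Sum>k. a k n) = fps_nth (g * h) n" for n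
    unfolding fps_mult_nth by (subst suminf_finite[of "{0..n}"]) (auto simp: a_def)
  ultimately show ?thesis by simp
qed

section \<open>Solutions of the complex system and their linearity\<close>

definition complex_frac_solution :: "real \<Rightarrow> complex^'n^'n \<Rightarrow> (nat \<Rightarrow> complex^'n) \<Rightarrow> bool" where
  "complex_frac_solution \<alpha> B X \<longleftrightarrow>
     (\<forall>t. X (Suc t) = X 0 + (\<Sum>j\<le>t. frac_coeff \<alpha> (t - j) *\<^sub>R (B *v X j)))"

fun frac_flow :: "real \<Rightarrow> complex^'n^'n \<Rightarrow> complex^'n \<Rightarrow> nat \<Rightarrow> complex^'n" where
  "frac_flow \<alpha> B v 0 = v"
| "frac_flow \<alpha> B v (Suc t) = v + (\<Sum>j\<le>t. frac_coeff \<alpha> (t - j) *\<^sub>R (B *v frac_flow \<alpha> B v j))"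

lemma complex_frac_solution_flow: "complex_frac_solution \<alpha> B (frac_flow \<alpha> B v)"
  by (simp add: complex_frac_solution_def)

lemma complex_frac_solution_eq_flow:
  assumes "complex_frac_solution \<alpha> B X"
  shows "X t = frac_flow \<alpha> B (X 0) t"
proof (induction t rule: less_induct)
  case (less t)
  show ?case
  proof (cases t)
    case (Suc s)
    then have "X t = X 0 + (\<Sum>j\<le>s. frac_coeff \<alpha> (s - j) *\<^sub>R (B *v X j))"
      using assms by (simp add: complex_frac_solution_def)
    also have "(\<Sum>j\<le>s. frac_coeff \<alpha> (s - j) *\<^sub>R (B *v X j)) =
        (\<Sum>j\<le>s. frac_coeff \<alpha> (s - j) *\<^sub>R (B *v frac_flow \<alpha> B (X 0) j))"
      using less Suc by (intro sum.cong) (auto simp flip: less)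
    finally show ?thesis using Suc by simp
  qed simp
qed

text \<open>A linear map commuting with \<open>B\<close> sends solutions to solutions, and solutions
  are determined by their initial value. It is applied to scalar multiplication and to
  \<open>mat \<mu> - B\<close>.\<close>

lemma frac_flow_linear:
  assumes L: "linear L" and comm: "\<And>x. L (B *v x) = B *v L x"
  shows "frac_flow \<alpha> B (L v) t = L (frac_flow \<alpha> B v t)"
proof -
  have "complex_frac_solution \<alpha> B (\<lambda>t. L (frac_flow \<alpha> B v t))"
    by (simp add: complex_frac_solution_def comm linear_add[OF L] linear_sum[OF L] linear_cmul[OF L])
  from complex_frac_solution_eq_flow[OF this] show ?thesis by simp
qed

lemma frac_flow_add:
  "frac_flow \<alpha> B (u + v) t = frac_flow \<alpha> B u t + frac_flow \<alpha> B v t"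
proof -
  have "complex_frac_solution \<alpha> B (\<lambda>t. frac_flow \<alpha> B u t + frac_flow \<alpha> B v t)"
    by (simp add: complex_frac_solution_def matrix_vector_right_distrib scaleR_right_distrib sum.distrib)
  from complex_frac_solution_eq_flow[OF this] show ?thesis by simp
qed

lemma matrix_vector_mult_smult: "B *v (c *s x) = c *s (B *v x)" for B :: "complex^'n^'m"
  by (simp add: matrix_vector_mult_def vec_eq_iff sum_distrib_left mult_ac)

lemma linear_vector_smult: "linear (\<lambda>x :: complex^'n. c *s x)"
  by (rule linearI) (auto simp: vec_eq_iff algebra_simps)

lemma frac_flow_smult: "frac_flow \<alpha> B (c *s v) t = c *s frac_flow \<alpha> B v t"
  by (rule frac_flow_linear[OF linear_vector_smult]) (simp add: matrix_vector_mult_smult)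

lemma frac_flow_0: "frac_flow \<alpha> B 0 t = 0"
  using frac_flow_smult[of \<alpha> B 0 0 t] by simp

lemma frac_flow_sum: "frac_flow \<alpha> B (\<Sum>i\<in>I. f i) t = (\<Sum>i\<in>I. frac_flow \<alpha> B (f i) t)"
  by (induction I rule: infinite_finite_induct) (auto simp: frac_flow_add frac_flow_0)

section \<open>Generating functions of solutions\<close>

definition component_fps :: "(nat \<Rightarrow> complex^'n) \<Rightarrow> 'n \<Rightarrow> complex fps" where
  "component_fps X i = Abs_fps (\<lambda>t. X t $ i)"

lemma fps_nth_component_fps: "fps_nth (component_fps X i) = (\<lambda>t. X t $ i)"
  by (rule ext) (simp add: component_fps_def)

text \<open>In the recursion the constant initial term contributes the geometric series
  \<open>pow_series (- 1)\<close>, the kernel contributes \<open>pow_series (- \<alpha>)\<close> and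
  the index shift \<open>fps_X\<close>. Multiplying by \<open>pow_series \<alpha>\<close> clears the
  kernel.\<close>

lemma component_fps_solution:
  assumes \<alpha>: "0 < \<alpha>" and X: "complex_frac_solution \<alpha> B X"
  shows "component_fps X i * pow_series \<alpha> =
    fps_const (X 0 $ i) * pow_series (\<alpha> - 1) + fps_X * component_fps (\<lambda>t. B *v X t) i"
proof -
  define Y where "Y = component_fps (\<lambda>t. B *v X t) i"
  have "component_fps X i = fps_const (X 0 $ i) * pow_series (- 1) + fps_X * (pow_series (- \<alpha>) * Y)"
  proof (rule fps_ext)
    fix n
    show "fps_nth (component_fps X i) n =
        fps_nth (fps_const (X 0 $ i) * pow_series (- 1) + fps_X * (pow_series (- \<alpha>) * Y)) n"
    proof (cases n)
      case 0 then show ?thesis by (simp add: component_fps_def pow_series_nth_0)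
    next
      case (Suc t)
      have "X n $ i = X 0 $ i + (\<Sum>j\<le>t. of_real (frac_coeff \<alpha> (t - j)) * (B *v X j) $ i)"
        using X Suc by (simp add: complex_frac_solution_def scaleR_conv_of_real[where 'a = complex])
      also have "(\<Sum>j\<le>t. of_real (frac_coeff \<alpha> (t - j)) * (B *v X j) $ i) = fps_nth (Y * pow_series (- \<alpha>)) t"
        unfolding fps_mult_nth atLeast0AtMost
        by (intro sum.cong) (auto simp: Y_def component_fps_def frac_coeff_pow_series[OF \<alpha>])
      finally show ?thesis using Suc by (simp add: component_fps_def pow_series_minus_1_nth mult.commute)
    qed
  qed
  then have "component_fps X i * pow_series \<alpha> =
      fps_const (X 0 $ i) * (pow_series (- 1) * pow_series \<alpha>) + fps_X * (pow_series (- \<alpha>) * pow_series \<alpha>) * Y"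
    by (simp add: algebra_simps)
  then show ?thesis by (simp add: pow_series_mult pow_series_0 Y_def add.commute)
qed

definition symbol_fps :: "real \<Rightarrow> complex \<Rightarrow> complex fps" where
  "symbol_fps \<alpha> \<mu> = pow_series \<alpha> - fps_const \<mu> * fps_X"

lemma symbol_fps_nth_0: "fps_nth (symbol_fps \<alpha> \<mu>) 0 = 1"
  by (simp add: symbol_fps_def pow_series_nth_0)

lemma matrix_mat_diff_mult: "(mat \<mu> - B) *v x = \<mu> *s x - B *v (x :: complex^'n)"
proof -
  have "mat \<mu> *v x = \<mu> *s x"
    by (simp add: vec_eq_iff matrix_vector_mult_def mat_def if_distrib if_distribR cong: if_cong)
  then show ?thesis by (simp add: matrix_vector_mult_diff_rdistrib)
qed

text \<open>Replacing \<open>B *v X t\<close> by \<open>\<mu> *s X t\<close> minus the residual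
  decouples the components: each generating function times the scalar symbol has coefficients
  tending to 0, and the summable inverse of the symbol preserves this.\<close>

lemma solution_tendsto_0_if_residual:
  assumes \<alpha>: "0 < \<alpha>" and X: "complex_frac_solution \<alpha> B X"
    and R: "(\<lambda>t. (mat \<mu> - B) *v X t) \<longlonglongrightarrow> 0"
    and l1: "fps_l1 (inverse (symbol_fps \<alpha> \<mu>))"
  shows "X \<longlonglongrightarrow> 0"
proof (rule vec_tendstoI)
  fix i
  define R' where "R' = component_fps (\<lambda>t. (mat \<mu> - B) *v X t) i"
  define g where "g = inverse (symbol_fps \<alpha> \<mu>)"
  have gf: "symbol_fps \<alpha> \<mu> * g = 1"
    unfolding g_def by (rule inverse_mult_eq_1') (simp add: symbol_fps_nth_0)
  have BX: "component_fps (\<lambda>t. B *v X t) i = fps_const \<mu> * component_fps X i - R'"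
    by (rule fps_ext) (simp add: R'_def component_fps_def matrix_mat_diff_mult)
  have "component_fps X i * symbol_fps \<alpha> \<mu> = fps_const (X 0 $ i) * pow_series (\<alpha> - 1) - fps_X * R'"
    using component_fps_solution[OF \<alpha> X, of i] unfolding BX by (simp add: symbol_fps_def algebra_simps)
  then have eq: "component_fps X i = g * (fps_const (X 0 $ i) * pow_series (\<alpha> - 1) - fps_X * R')"
    using gf by (metis mult.assoc mult.commute mult_1)
  have R'0: "fps_nth R' \<longlonglongrightarrow> 0"
    using tendsto_vec_nth[OF R, of i] by (simp add: R'_def fps_nth_component_fps)
  have "fps_nth (fps_X * R') \<longlonglongrightarrow> 0"
    by (rule LIMSEQ_imp_Suc) (simp add: R'0)
  then have "fps_nth (fps_const (X 0 $ i) * pow_series (\<alpha> - 1) - fps_X * R') \<longlonglongrightarrow> (X 0 $ i) * 0 - 0"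
    unfolding fps_sub_nth fps_mult_left_const_nth
    by (intro tendsto_intros pow_series_nth_tendsto_0 \<alpha>)
  then have "fps_nth (component_fps X i) \<longlonglongrightarrow> 0"
    unfolding eq using l1 by (intro fps_l1_mult_tendsto_0) (auto simp: g_def)
  then show "(\<lambda>t. X t $ i) \<longlonglongrightarrow> 0 $ i" by (simp add: fps_nth_component_fps)
qed

lemma tendsto_matrix_vector_mult:
  fixes C :: "complex^'n^'m"
  assumes "(X \<longlongrightarrow> x) F"
  shows "((\<lambda>t. C *v X t) \<longlongrightarrow> C *v x) F"
  unfolding matrix_vector_mult_def
  by (intro tendsto_vec_lambda tendsto_intros tendsto_vec_nth[OF assms])

text \<open>The flow commutes with \<open>mat \<mu> - B\<close>, so \<open>step\<close> says that
  the residual of the flow from \<open>v\<close> tends to 0. The nonsingular case, settled by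
  inverting the matrix, covers roots of an annihilating polynomial that are not eigenvalues, about
  which \<open>l1\<close> says nothing.\<close>

lemma frac_flow_tendsto_0_step:
  assumes \<alpha>: "0 < \<alpha>"
    and l1: "\<And>\<mu>. det (mat \<mu> - B) = 0 \<Longrightarrow> fps_l1 (inverse (symbol_fps \<alpha> \<mu>))"
    and step: "frac_flow \<alpha> B ((mat \<mu> - B) *v v) \<longlonglongrightarrow> 0"
  shows "frac_flow \<alpha> B v \<longlonglongrightarrow> 0"
proof -
  have "frac_flow \<alpha> B ((mat \<mu> - B) *v v) t = (mat \<mu> - B) *v frac_flow \<alpha> B v t" for t
    by (rule frac_flow_linear[OF matrix_vector_mul_linear])
      (simp add: matrix_mat_diff_mult matrix_vector_mult_diff_distrib matrix_vector_mult_smult)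
  then have R: "(\<lambda>t. (mat \<mu> - B) *v frac_flow \<alpha> B v t) \<longlonglongrightarrow> 0"
    using step by (rule Lim_transform_eventually[rotated, OF always_eventually, OF allI])
  show ?thesis
  proof (cases "det (mat \<mu> - B) = 0")
    case True
    from solution_tendsto_0_if_residual[OF \<alpha> complex_frac_solution_flow R l1[OF True]] show ?thesis .
  next
    case False
    then obtain C where C: "C ** (mat \<mu> - B) = mat 1"
      using invertible_det_nz invertible_left_inverse by blast
    have "(\<lambda>t. C *v ((mat \<mu> - B) *v frac_flow \<alpha> B v t)) \<longlonglongrightarrow> C *v 0"
      by (rule tendsto_matrix_vector_mult[OF R])
    then show ?thesis using C by (simp add: matrix_vector_mul_assoc)
  qed
qed

section \<open>Annihilating polynomials and induction on their degree\<close>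

definition poly_apply :: "complex^'n^'n \<Rightarrow> complex poly \<Rightarrow> complex^'n \<Rightarrow> complex^'n" where
  "poly_apply B q v = (\<Sum>k\<le>degree q. coeff q k *s (((*v) B ^^ k) v))"

lemma poly_apply_eq:
  "degree q \<le> n \<Longrightarrow> poly_apply B q v = (\<Sum>k\<le>n. coeff q k *s (((*v) B ^^ k) v))"
  unfolding poly_apply_def by (intro sum.mono_neutral_left) (auto simp: coeff_eq_0)

text \<open>Since polynomials in \<open>B\<close> commute, the linear factor can act on
  \<open>v\<close> first. Thus the cofactor of an annihilating polynomial of \<open>v\<close>
  annihilates \<open>B *v v - \<mu> *s v\<close>.\<close>

lemma poly_apply_linear_factor:
  "poly_apply B ([:- \<mu>, 1:] * q) v = poly_apply B q (B *v v - \<mu> *s v)"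
proof -
  let ?n = "degree q"
  have lin: "((*v) B ^^ k) (x - c *s y) = ((*v) B ^^ k) x - c *s (((*v) B ^^ k) y)" for k c x y
    by (induction k) (auto simp: matrix_vector_mult_diff_distrib matrix_vector_mult_smult)
  have "degree ([:- \<mu>, 1:] * q) \<le> Suc ?n"
    using degree_mult_le[of "[:- \<mu>, 1:]" q] by simp
  then have "poly_apply B ([:- \<mu>, 1:] * q) v =
      (\<Sum>k\<le>Suc ?n. coeff ([:- \<mu>, 1:] * q) k *s (((*v) B ^^ k) v))"
    by (rule poly_apply_eq)
  also have "\<dots> = (\<Sum>k\<le>Suc ?n. coeff (pCons 0 q) k *s (((*v) B ^^ k) v)) -
      (\<Sum>k\<le>Suc ?n. (\<mu> * coeff q k) *s (((*v) B ^^ k) v))"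
    by (simp add: sum_subtractf[symmetric] vec_eq_iff algebra_simps del: sum.atMost_Suc)
  also have "(\<Sum>k\<le>Suc ?n. coeff (pCons 0 q) k *s (((*v) B ^^ k) v)) =
      (\<Sum>k\<le>?n. coeff q k *s (((*v) B ^^ k) (B *v v)))"
    by (subst sum.atMost_Suc_shift) (simp add: funpow_swap1)
  also have "(\<Sum>k\<le>Suc ?n. (\<mu> * coeff q k) *s (((*v) B ^^ k) v)) =
      (\<Sum>k\<le>?n. (\<mu> * coeff q k) *s (((*v) B ^^ k) v))"
    by (simp add: coeff_eq_0)
  finally show ?thesis
    unfolding poly_apply_def lin by (simp add: vec_eq_iff algebra_simps sum_subtractf)
qed

lemma exists_annihilating_poly:
  obtains q where "q \<noteq> 0" "poly_apply B q (v :: complex^'n) = 0"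
proof -
  define N where "N = CARD('n)"
  define f where "f k = ((*v) B ^^ k) v" for k
  have pa: "poly_apply B q v = (\<Sum>k\<le>N. coeff q k *s f k)" if "degree q \<le> N" for q
    using poly_apply_eq[OF that] by (simp add: f_def)
  have "\<exists>c. (\<exists>k\<le>N. c k \<noteq> 0) \<and> (\<Sum>k\<le>N. c k *s f k) = 0"
  \<comment> \<open>The \<open>N + 1\<close> iterates live in dimension \<open>N\<close>, but linear
    dependence is a property of sets. If two iterates coincide, the coefficients 1 and -1 at their
    indices give the relation directly.\<close>
  proof (cases "inj_on f {..N}")
    case True
    have "vec.dim (f ` {..N}) \<le> N"
      unfolding N_def by (rule dim_subset_UNIV_cart_gen)
    then have "vec.dependent (f ` {..N})"
      using True by (intro vec.dependent_biggerset_general) (simp add: card_image)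
    then obtain u where u: "\<exists>w\<in>f ` {..N}. u w \<noteq> 0" "(\<Sum>w\<in>f ` {..N}. u w *s w) = 0"
      by (subst (asm) vec.dependent_finite) auto
    then show ?thesis
      by (intro exI[of _ "\<lambda>k. u (f k)"]) (auto simp: sum.reindex[OF True])
  next
    case False
    then obtain i j where ij: "i \<le> N" "j \<le> N" "i \<noteq> j" "f i = f j" by (auto simp: inj_on_def)
    have "(\<Sum>k\<le>N. ((if k = i then 1 else 0) - (if k = j then 1 else 0)) *s f k) =
        (\<Sum>k\<le>N. (if k = i then f k else 0) - (if k = j then f k else 0))"
      by (intro sum.cong) auto
    also have "\<dots> = f i - f j"
      using ij by (simp add: sum_subtractf)
    finally have "(\<Sum>k\<le>N. ((if k = i then 1 else 0) - (if k = j then 1 else 0)) *s f k) = f i - f j" .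
    then show ?thesis
      using ij by (intro exI[of _ "\<lambda>k. (if k = i then 1 else 0) - (if k = j then 1 else 0)"]) auto
  qed
  then obtain c k where c: "k \<le> N" "c k \<noteq> 0" "(\<Sum>k\<le>N. c k *s f k) = 0" by auto
  define q where "q = (\<Sum>k\<le>N. monom (c k) k)"
  have coeff: "coeff q k = (if k \<le> N then c k else 0)" for k
    by (simp add: q_def coeff_sum)
  have "degree q \<le> N" by (rule degree_le) (simp add: coeff)
  then have "poly_apply B q v = 0" using c(3) by (subst pa) (auto simp: coeff)
  moreover have "q \<noteq> 0" using coeff[of k] c by auto
  ultimately show thesis by (rule that[rotated])
qed

text \<open>Induction on the degree: a nonzero constant annihilates only 0; otherwise a root
  \<open>\<mu>\<close> is split off, the claim holds for \<open>B *v v - \<mu> *s v\<close>, and the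
  step lemma returns to \<open>v\<close>.\<close>

lemma frac_flow_tendsto_0_if_annihilated:
  assumes \<alpha>: "0 < \<alpha>"
    and l1: "\<And>\<mu>. det (mat \<mu> - B) = 0 \<Longrightarrow> fps_l1 (inverse (symbol_fps \<alpha> \<mu>))"
    and q: "q \<noteq> 0" "poly_apply B q v = 0"
  shows "frac_flow \<alpha> B v \<longlonglongrightarrow> 0"
  using q
proof (induction "degree q" arbitrary: q v rule: less_induct)
  case less
  show ?case
  proof (cases "degree q = 0")
    case True
    then obtain c where "q = [:c:]" by (rule degree_eq_zeroE)
    then have "v = 0" using less(2,3) by (simp add: poly_apply_def vec_eq_iff)
    moreover have "frac_flow \<alpha> B 0 = (\<lambda>t. 0)" by (rule ext) (rule frac_flow_0)
    ultimately show ?thesis by simp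
  next
    case False
    then obtain \<mu> where "poly q \<mu> = 0"
      using fundamental_theorem_of_algebra_alt[of q] by (metis degree_pCons_0)
    then obtain q' where q': "q = [:- \<mu>, 1:] * q'" by (metis poly_eq_0_iff_dvd dvdE)
    then have nz: "q' \<noteq> 0" using less by auto
    then have "degree q' < degree q" unfolding q' by (subst degree_mult_eq) auto
    moreover have "poly_apply B q' (B *v v - \<mu> *s v) = 0"
      using less(3) unfolding q' by (simp only: poly_apply_linear_factor)
    ultimately have "frac_flow \<alpha> B (B *v v - \<mu> *s v) \<longlonglongrightarrow> 0" using nz less(1) by blast
    moreover have "frac_flow \<alpha> B ((mat \<mu> - B) *v v) = (\<lambda>t. - frac_flow \<alpha> B (B *v v - \<mu> *s v) t)"
    proof
      fix t
      have "(mat \<mu> - B) *v v = (- 1) *s (B *v v - \<mu> *s v)"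
        by (simp add: matrix_mat_diff_mult)
      then show "frac_flow \<alpha> B ((mat \<mu> - B) *v v) t = - frac_flow \<alpha> B (B *v v - \<mu> *s v) t"
        by (simp only: frac_flow_smult) simp
    qed
    ultimately have "frac_flow \<alpha> B ((mat \<mu> - B) *v v) \<longlonglongrightarrow> 0"
      by (simp add: tendsto_minus_cancel_left[symmetric])
    then show ?thesis using frac_flow_tendsto_0_step[OF \<alpha>] l1 by blast
  qed
qed

section \<open>The symbol and the characteristic equation\<close>

lemma eval_symbol_fps:
  assumes "0 < \<alpha>" "\<alpha> < 1" "norm w \<le> 1"
  shows "eval_fps (symbol_fps \<alpha> \<mu>) w = (1 - w) powr of_real \<alpha> - \<mu> * w"
  unfolding symbol_fps_def
  using assms eval_pow_series[OF assms]
  by (subst eval_fps_l1_diff) (auto intro: fps_l1_pow_series fps_l1_cmult fps_l1_X simp: eval_fps_mult)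

lemma fps_l1_symbol_fps: "0 < \<alpha> \<Longrightarrow> \<alpha> < 1 \<Longrightarrow> fps_l1 (symbol_fps \<alpha> \<mu>)"
  unfolding symbol_fps_def by (intro fps_l1_diff fps_l1_pow_series fps_l1_cmult fps_l1_X)

lemma char_fun_symbol_fps:
  assumes \<alpha>: "0 < \<alpha>" "\<alpha> < 1" and w: "norm w \<le> 1" "w \<noteq> 0"
    and root: "eval_fps (symbol_fps \<alpha> \<mu>) w = 0"
  shows "char_fun \<alpha> A (1 / w) = det (mat \<mu> - cmat (A - mat 1))"
proof -
  have "1 / w * (1 - w) powr of_real \<alpha> = \<mu>"
    using root w by (simp add: eval_symbol_fps[OF \<alpha>] field_simps)
  then show ?thesis by (simp add: char_fun_def)
qed

text \<open>The substitution \<open>w = 1 / z\<close> exchanges \<open>1 \<le> norm z\<close> with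
  the punctured closed disc. The centre \<open>w = 0\<close> is never a root, because the symbol
  equals 1 there.\<close>

lemma char_fun_nonzero_iff_symbol_nonzero:
  assumes \<alpha>: "0 < \<alpha>" "\<alpha> < 1"
  shows "(\<forall>z. 1 \<le> norm z \<longrightarrow> char_fun \<alpha> A z \<noteq> 0) \<longleftrightarrow>
    (\<forall>\<mu> w. det (mat \<mu> - cmat (A - mat 1)) = 0 \<longrightarrow> norm w \<le> 1 \<longrightarrow> eval_fps (symbol_fps \<alpha> \<mu>) w \<noteq> 0)"
    (is "?L \<longleftrightarrow> ?R")
proof
  assume L: ?L
  show ?R
  proof (intro allI impI notI)
    fix \<mu> w assume *: "det (mat \<mu> - cmat (A - mat 1)) = 0" "norm w \<le> 1" "eval_fps (symbol_fps \<alpha> \<mu>) w = 0"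
    then have "w \<noteq> 0" by (auto simp: eval_fps_at_0 symbol_fps_nth_0)
    then show False using L * char_fun_symbol_fps[OF \<alpha> *(2) _ *(3), of A]
      by (auto simp: norm_divide)
  qed
next
  assume R: ?R
  show ?L
  proof (intro allI impI notI)
    fix z assume z: "1 \<le> norm z" "char_fun \<alpha> A z = 0"
    \<comment> \<open>With this \<open>\<mu>\<close> the matrix inside \<open>char_fun\<close> is
      \<open>mat \<mu> - cmat (A - mat 1)\<close>, so the root \<open>z\<close> makes
      \<open>\<mu>\<close> an eigenvalue.\<close>
    define \<mu> where "\<mu> = z * (1 - 1 / z) powr of_real \<alpha>"
    have w: "norm (1 / z) \<le> 1" using z by (simp add: norm_divide divide_le_eq_1)
    have "eval_fps (symbol_fps \<alpha> \<mu>) (1 / z) = 0"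
      using z by (subst eval_symbol_fps[OF \<alpha> w]) (auto simp: \<mu>_def)
    then show False using R z w by (auto simp: char_fun_def \<mu>_def)
  qed
qed

lemma frac_flow_tendsto_0:
  assumes \<alpha>: "0 < \<alpha>" "\<alpha> < 1"
    and nz: "\<And>\<mu> w. det (mat \<mu> - B) = 0 \<Longrightarrow> norm w \<le> 1 \<Longrightarrow> eval_fps (symbol_fps \<alpha> \<mu>) w \<noteq> 0"
  shows "frac_flow \<alpha> B v \<longlonglongrightarrow> 0"
proof -
  obtain q where "q \<noteq> 0" "poly_apply B q v = 0" by (rule exists_annihilating_poly)
  then show ?thesis
    by (intro frac_flow_tendsto_0_if_annihilated[OF \<alpha>(1)] wiener_lemma_disc fps_l1_symbol_fps \<alpha> nz)
qed

section \<open>Eigenvector solutions and roots in the closed disc\<close>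

text \<open>Generating function of the solution with initial value 1 when \<open>B\<close> is
  replaced by the scalar \<open>\<mu>\<close>.\<close>

definition scalar_solution :: "real \<Rightarrow> complex \<Rightarrow> complex fps" where
  "scalar_solution \<alpha> \<mu> = pow_series (\<alpha> - 1) * inverse (symbol_fps \<alpha> \<mu>)"

lemma scalar_solution_mult_symbol:
  "scalar_solution \<alpha> \<mu> * symbol_fps \<alpha> \<mu> = pow_series (\<alpha> - 1)"
proof -
  have "inverse (symbol_fps \<alpha> \<mu>) * symbol_fps \<alpha> \<mu> = 1"
    by (rule inverse_mult_eq_1) (simp add: symbol_fps_nth_0)
  then show ?thesis by (simp add: scalar_solution_def mult.assoc)
qed

text \<open>Multiplying the closed form by \<open>pow_series (- \<alpha>)\<close> turns it back into
  the recursion.\<close>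

lemma scalar_solution_rec:
  "scalar_solution \<alpha> \<mu> = pow_series (- 1) + fps_X * (fps_const \<mu> * (scalar_solution \<alpha> \<mu> * pow_series (- \<alpha>)))"
proof -
  let ?x = "scalar_solution \<alpha> \<mu>"
  have "?x * symbol_fps \<alpha> \<mu> * pow_series (- \<alpha>) = pow_series (- 1)"
    by (simp add: scalar_solution_mult_symbol pow_series_mult)
  moreover have "?x * symbol_fps \<alpha> \<mu> * pow_series (- \<alpha>) =
      ?x * (pow_series \<alpha> * pow_series (- \<alpha>)) - fps_X * (fps_const \<mu> * (?x * pow_series (- \<alpha>)))"
    by (simp add: symbol_fps_def algebra_simps)
  ultimately show ?thesis by (simp add: pow_series_mult pow_series_0 algebra_simps)
qed

lemma complex_frac_solution_eigenvector:
  assumes \<alpha>: "0 < \<alpha>" and v: "B *v v = \<mu> *s v"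
  shows "complex_frac_solution \<alpha> B (\<lambda>t. fps_nth (scalar_solution \<alpha> \<mu>) t *s v)"
  unfolding complex_frac_solution_def
proof
  fix t
  let ?x = "fps_nth (scalar_solution \<alpha> \<mu>)"
  have "?x 0 = 1"
    by (subst scalar_solution_rec) (simp add: pow_series_minus_1_nth)
  moreover have "fps_nth (scalar_solution \<alpha> \<mu> * pow_series (- \<alpha>)) t =
      (\<Sum>j\<le>t. ?x j * of_real (frac_coeff \<alpha> (t - j)))"
    by (simp add: frac_coeff_pow_series[OF \<alpha>] fps_mult_nth atLeast0AtMost)
  then have "?x (Suc t) = 1 + \<mu> * (\<Sum>j\<le>t. ?x j * of_real (frac_coeff \<alpha> (t - j)))"
    by (subst scalar_solution_rec) (simp add: pow_series_minus_1_nth)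
  moreover have "(\<Sum>j\<le>t. frac_coeff \<alpha> (t - j) *\<^sub>R (B *v (?x j *s v))) =
      (\<mu> * (\<Sum>j\<le>t. ?x j * of_real (frac_coeff \<alpha> (t - j)))) *s v"
    by (simp add: matrix_vector_mult_smult v vec_eq_iff sum_distrib_left sum_distrib_right
      scaleR_conv_of_real[where 'a = complex] mult_ac)
  ultimately show "?x (Suc t) *s v = ?x 0 *s v + (\<Sum>j\<le>t. frac_coeff \<alpha> (t - j) *\<^sub>R (B *v (?x j *s v)))"
    by (simp add: vector_sadd_rdistrib)
qed

text \<open>With \<open>r = 1 - 1 / real (Suc n)\<close>, the head of the series contributes at most
  the constant \<open>C\<close>, which the factor \<open>1 - r\<close> sends to 0. The tail is at
  most \<open>\<epsilon> / 2\<close> times the geometric sum \<open>1 / (1 - r)\<close>, which that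
  factor cancels.\<close>

lemma abel_mean_tendsto_0:
  fixes x :: "nat \<Rightarrow> complex"
  assumes x: "x \<longlonglongrightarrow> 0" and w: "norm w \<le> 1"
  shows "(\<lambda>n. of_real (1 / real (Suc n)) * (\<Sum>k. x k * (of_real (1 - 1 / real (Suc n)) * w) ^ k)) \<longlonglongrightarrow> 0"
proof (rule tendstoI)
  fix \<epsilon> :: real assume \<epsilon>: "0 < \<epsilon>"
  then obtain K where K: "\<And>k. k \<ge> K \<Longrightarrow> norm (x k) < \<epsilon> / 2"
    using LIMSEQ_D[OF x, of "\<epsilon> / 2"] by auto
  define C where "C = (\<Sum>k<K. norm (x k))"
  have "(\<lambda>n. C / real (Suc n)) \<longlonglongrightarrow> 0" by real_asymp
  then have "eventually (\<lambda>n. C / real (Suc n) < \<epsilon> / 2) sequentially"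
    using \<epsilon> by (intro order_tendstoD) auto
  then show "eventually (\<lambda>n. dist (of_real (1 / real (Suc n)) *
      (\<Sum>k. x k * (of_real (1 - 1 / real (Suc n)) * w) ^ k)) 0 < \<epsilon>) sequentially"
  proof eventually_elim
    case (elim n)
    define r where "r = 1 - 1 / real (Suc n)"
    have r: "0 \<le> r" "r < 1" by (auto simp: r_def field_simps)
    have r': "1 - r = 1 / real (Suc n)" by (simp add: r_def)
    define b where "b k = (if k < K then norm (x k) else 0) + \<epsilon> / 2 * r ^ k" for k
    have b: "b sums (C + \<epsilon> / 2 * (1 / (1 - r)))"
      unfolding b_def
    proof (intro sums_add sums_mult geometric_sums)
      show "(\<lambda>k. if k < K then norm (x k) else 0) sums C"
        using sums_If_finite_set[of "{..<K}" "\<lambda>k. norm (x k)"] by (simp add: C_def)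
    qed (use r in auto)
    have le: "norm (x k * (of_real r * w) ^ k) \<le> b k" for k
    proof -
      have "norm (of_real r * w) \<le> r" using w r mult_left_le[of "norm w" r] by (simp add: norm_mult)
      then have rk: "norm (of_real r * w) ^ k \<le> r ^ k" by (intro power_mono) auto
      have r1: "r ^ k \<le> 1" using r by (simp add: power_le_one)
      show ?thesis
      proof (cases "k < K")
        case True
        have "norm (x k) * norm (of_real r * w) ^ k \<le> norm (x k) * 1"
          using rk r1 by (intro mult_left_mono) auto
        moreover have "0 \<le> \<epsilon> / 2 * r ^ k" using r \<epsilon> by simp
        ultimately show ?thesis using True by (simp add: b_def norm_mult norm_power)
      next
        case False
        have "norm (x k) * norm (of_real r * w) ^ k \<le> \<epsilon> / 2 * r ^ k"
          using rk K[of k] False \<epsilon> by (intro mult_mono) auto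
        then show ?thesis using False by (simp add: b_def norm_mult norm_power)
      qed
    qed
    have s: "summable (\<lambda>k. norm (x k * (of_real r * w) ^ k))"
      by (rule summable_comparison_test'[OF sums_summable[OF b]]) (use le in auto)
    have "norm (\<Sum>k. x k * (of_real r * w) ^ k) \<le> C + \<epsilon> / 2 * (1 / (1 - r))"
      unfolding sums_unique[OF b]
      by (rule order_trans[OF summable_norm[OF s] suminf_le[OF le s sums_summable[OF b]]])
    then have "(1 - r) * norm (\<Sum>k. x k * (of_real r * w) ^ k) \<le> (1 - r) * (C + \<epsilon> / 2 * (1 / (1 - r)))"
      using r by (intro mult_left_mono) auto
    also have "\<dots> = (1 - r) * C + \<epsilon> / 2" using r by (simp add: field_simps)
    also have "\<dots> = C / real (Suc n) + \<epsilon> / 2" by (simp add: r')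
    also have "\<dots> < \<epsilon>" using elim by linarith
    finally have "norm (of_real (1 - r) * (\<Sum>k. x k * (of_real r * w) ^ k)) < \<epsilon>"
      using r by (simp only: norm_mult norm_of_real)
    then show ?case unfolding r' unfolding r_def dist_norm diff_zero .
  qed
qed

lemma scalar_solution_not_tendsto_0:
  assumes \<alpha>: "0 < \<alpha>" "\<alpha> < 1" and w: "norm w \<le> 1"
    and root: "eval_fps (symbol_fps \<alpha> \<mu>) w = 0"
  shows "\<not> fps_nth (scalar_solution \<alpha> \<mu>) \<longlonglongrightarrow> 0"
proof
  assume x0: "fps_nth (scalar_solution \<alpha> \<mu>) \<longlonglongrightarrow> 0"
  let ?x = "fps_nth (scalar_solution \<alpha> \<mu>)" and ?S = "symbol_fps \<alpha> \<mu>"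
  show False
  proof (cases "w = 1")
    case True
    \<comment> \<open>At \<open>w = 1\<close> the power is \<open>0 powr \<alpha> = 0\<close>, so
      the root condition reduces to \<open>\<mu> = 0\<close>.\<close>
    then have "\<mu> = 0" using root w by (simp add: eval_symbol_fps[OF \<alpha>])
    then have "?x n = 1" for n
      by (subst scalar_solution_rec) (simp add: pow_series_minus_1_nth)
    then have "?x = (\<lambda>n. 1)" by (rule ext)
    with x0 show False by (simp add: LIMSEQ_const_iff)
  next
    case False
    have w0: "w \<noteq> 0" using root by (auto simp: eval_fps_at_0 symbol_fps_nth_0)
    have nonneg: "1 - w \<notin> \<real>\<^sub>\<le>\<^sub>0"
      using w False abs_Re_le_cmod[of w] by (auto simp: complex_nonpos_Reals_iff complex_eq_iff)
    define F where "F u = (1 - u) powr of_real \<alpha> - \<mu> * u" for u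
    define r where "r n = 1 - 1 / real (Suc n)" for n
    have r: "0 \<le> r n" "r n < 1" for n by (auto simp: r_def field_simps)
    define u where "u n = of_real (r n) * w" for n
    have u1: "norm (u n) < 1" for n
    proof -
      have "norm (u n) \<le> r n" using w r mult_left_le[of "norm w" "r n"] by (simp add: u_def norm_mult)
      then show ?thesis using r[of n] by simp
    qed
    have "r \<longlonglongrightarrow> 1" unfolding r_def by real_asymp
    then have u_lim: "u \<longlonglongrightarrow> w"
      unfolding u_def using tendsto_mult[OF tendsto_of_real tendsto_const[of w]] by fastforce
    have u_ne: "u n \<noteq> w" for n using w0 r[of n] by (simp add: u_def)
    have "\<exists>D. (F has_field_derivative D) (at w)"
      unfolding F_def using nonneg by (auto intro!: exI derivative_eq_intros)
    then obtain D where "(F has_field_derivative D) (at w)" by blast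
    then have "((\<lambda>y. (F y - F w) / (y - w)) \<longlongrightarrow> D) (at w)"
      by (simp add: has_field_derivative_iff)
    moreover have "filterlim u (at w) sequentially"
      using u_lim u_ne by (auto simp: filterlim_at intro!: always_eventually)
    ultimately have "(\<lambda>n. (F (u n) - F w) / (u n - w)) \<longlonglongrightarrow> D"
      by (rule filterlim_compose)
    then have quot: "(\<lambda>n. (F (u n) - F w) / (u n - w) * - w) \<longlonglongrightarrow> D * - w"
      by (intro tendsto_intros)
    have Fw: "F w = 0" using root by (simp add: eval_symbol_fps[OF \<alpha> w] F_def)
    have diff: "u n - w = - w / of_nat (Suc n)" for n
      by (simp add: u_def r_def algebra_simps)
    \<comment> \<open>As \<open>u n - w\<close> equals \<open>- w / of_nat (Suc n)\<close>,
      convergence of the difference quotient says that \<open>F (u n)\<close> is of order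
      \<open>1 / Suc n\<close>.\<close>
    have quot_eq: "(F (u n) - F w) / (u n - w) * - w = of_nat (Suc n) * F (u n)" for n
      unfolding diff Fw using w0 by (simp add: field_simps del: of_nat_Suc)
    define a where "a n = (\<Sum>k. ?x k * u n ^ k)" for n
    have mean: "(\<lambda>n. of_real (1 / real (Suc n)) * a n) \<longlonglongrightarrow> 0"
      using abel_mean_tendsto_0[OF x0 w] by (simp add: a_def u_def r_def)
    \<comment> \<open>Inside the disc both series converge absolutely, \<open>?x\<close> being
      bounded, so the formal identity \<open>scalar_solution_mult_symbol\<close> can be evaluated by
      the Cauchy product.\<close>
    have prod: "a n * F (u n) = (1 - u n) powr of_real (\<alpha> - 1)" for n
    proof -
      obtain H where H: "\<And>k. norm (?x k) \<le> H"
        using convergent_imp_Bseq[OF convergentI[OF x0]] by (auto simp: Bseq_def)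
      have sx: "summable (\<lambda>k. norm (?x k * u n ^ k))"
      proof (rule summable_comparison_test')
        show "summable (\<lambda>k. H * norm (u n) ^ k)"
          using u1[of n] by (intro summable_mult summable_geometric) auto
        show "norm (norm (?x k * u n ^ k)) \<le> H * norm (u n) ^ k" for k
          using H by (simp add: norm_mult norm_power mult_right_mono)
      qed
      have sS: "summable (\<lambda>k. norm (fps_nth ?S k * u n ^ k))"
        using u1[of n] by (intro fps_l1_summable fps_l1_symbol_fps \<alpha>) auto
      have "(\<Sum>i\<le>k. (?x i * u n ^ i) * (fps_nth ?S (k - i) * u n ^ (k - i))) =
          fps_nth (pow_series (\<alpha> - 1)) k * u n ^ k" for k
      proof -
        have "fps_nth (pow_series (\<alpha> - 1)) k * u n ^ k = (\<Sum>i\<le>k. ?x i * fps_nth ?S (k - i) * (u n ^ i * u n ^ (k - i)))"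
          unfolding scalar_solution_mult_symbol[symmetric, of \<alpha> \<mu>] fps_mult_nth atLeast0AtMost sum_distrib_right
          by (intro sum.cong) (auto simp flip: power_add)
        then show ?thesis by (simp add: mult_ac)
      qed
      then have "(\<lambda>k. fps_nth (pow_series (\<alpha> - 1)) k * u n ^ k) sums (a n * (\<Sum>k. fps_nth ?S k * u n ^ k))"
        using Cauchy_product_sums[OF sx sS] by (simp add: a_def)
      moreover have "(\<Sum>k. fps_nth ?S k * u n ^ k) = F (u n)"
        using eval_symbol_fps[OF \<alpha>, of "u n" \<mu>] u1[of n] by (simp add: eval_fps_def F_def)
      ultimately show ?thesis
        using pow_series_sums[OF u1[of n], of "\<alpha> - 1"] by (simp add: sums_iff)
    qed
    \<comment> \<open>The factors \<open>1 / Suc n\<close> and \<open>Suc n\<close> cancel, so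
      \<open>a n * F (u n)\<close> tends to 0, against its nonzero limit
      \<open>(1 - w) powr (\<alpha> - 1)\<close>.\<close>
    have "(\<lambda>n. (of_real (1 / real (Suc n)) * a n) * ((F (u n) - F w) / (u n - w) * - w)) \<longlonglongrightarrow> 0 * (D * - w)"
      by (intro tendsto_mult mean quot)
    moreover have "(of_real (1 / real (Suc n)) * a n) * ((F (u n) - F w) / (u n - w) * - w) = a n * F (u n)" for n
      unfolding quot_eq by (simp del: of_nat_Suc)
    ultimately have "(\<lambda>n. (1 - u n) powr of_real (\<alpha> - 1)) \<longlonglongrightarrow> 0"
      by (simp add: prod)
    moreover have "(\<lambda>n. (1 - u n) powr of_real (\<alpha> - 1)) \<longlonglongrightarrow> (1 - w) powr of_real (\<alpha> - 1)"
      by (intro tendsto_powr_complex tendsto_intros u_lim nonneg)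
    ultimately have "(1 - w) powr of_real (\<alpha> - 1) = 0" using LIMSEQ_unique by blast
    then show False using False by simp
  qed
qed

section \<open>Real and complex solutions\<close>

definition Re_vec :: "complex^'n \<Rightarrow> real^'n" where
  "Re_vec x = (\<chi> i. Re (x $ i))"

definition complex_vec :: "real^'n \<Rightarrow> complex^'n" where
  "complex_vec x = (\<chi> i. of_real (x $ i))"

lemma norm_vec_smult: "norm (c *s x) = norm c * norm x" for x :: "complex^'n"
  by (simp add: norm_vec_def norm_mult L2_set_right_distrib)

lemma norm_complex_vec: "norm (complex_vec x) = norm x"
  by (simp add: norm_vec_def complex_vec_def)

lemma norm_Re_vec_le: "norm (Re_vec x) \<le> norm x"
  unfolding norm_vec_def Re_vec_def by (intro L2_set_mono) (auto simp: abs_Re_le_cmod)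

lemma linear_Re_vec: "linear Re_vec"
  by (rule linearI) (auto simp: Re_vec_def vec_eq_iff)

lemma Re_vec_mult: "Re_vec (cmat B *v x) = B *v Re_vec x"
  by (simp add: Re_vec_def cmat_def vec_eq_iff matrix_vector_mult_def)

text \<open>Taking real parts is real-linear and commutes with a matrix having real entries.\<close>

lemma Re_vec_solution:
  assumes "complex_frac_solution \<alpha> (cmat (A - mat 1)) Y"
  shows "is_frac_solution \<alpha> A (\<lambda>t. Re_vec (Y t))"
  unfolding is_frac_solution_def
proof
  fix t
  have "Y (Suc t) = Y 0 + (\<Sum>j\<le>t. frac_coeff \<alpha> (t - j) *\<^sub>R (cmat (A - mat 1) *v Y j))"
    using assms by (simp add: complex_frac_solution_def)
  then show "Re_vec (Y (Suc t)) = Re_vec (Y 0) +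
      (\<Sum>j\<le>t. frac_coeff \<alpha> (t - j) *\<^sub>R ((A - mat 1) *v Re_vec (Y j)))"
    by (simp only: linear_add[OF linear_Re_vec] linear_sum[OF linear_Re_vec]
      linear_cmul[OF linear_Re_vec] Re_vec_mult)
qed

lemma linear_complex_vec: "linear complex_vec"
  by (rule linearI) (auto simp: complex_vec_def vec_eq_iff complex_eq_iff)

lemma complex_vec_mult: "complex_vec (B *v x) = cmat B *v complex_vec x"
  by (simp add: complex_vec_def cmat_def vec_eq_iff matrix_vector_mult_def)

lemma complex_vec_solution:
  assumes "is_frac_solution \<alpha> A X"
  shows "complex_frac_solution \<alpha> (cmat (A - mat 1)) (\<lambda>t. complex_vec (X t))"
  unfolding complex_frac_solution_def
proof
  fix t
  have "X (Suc t) = X 0 + (\<Sum>j\<le>t. frac_coeff \<alpha> (t - j) *\<^sub>R ((A - mat 1) *v X j))"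
    using assms by (simp add: is_frac_solution_def)
  then show "complex_vec (X (Suc t)) = complex_vec (X 0) +
      (\<Sum>j\<le>t. frac_coeff \<alpha> (t - j) *\<^sub>R (cmat (A - mat 1) *v complex_vec (X j)))"
    by (simp only: linear_add[OF linear_complex_vec] linear_sum[OF linear_complex_vec]
      linear_cmul[OF linear_complex_vec] complex_vec_mult)
qed

section \<open>Transfer of stability between real and complex solutions\<close>

lemma complex_frac_solution_smult:
  assumes "complex_frac_solution \<alpha> B Y"
  shows "complex_frac_solution \<alpha> B (\<lambda>t. c *s Y t)"
proof -
  have "c *s Y t = frac_flow \<alpha> B (c *s Y 0) t" for t
    using complex_frac_solution_eq_flow[OF assms, of t] by (simp only: frac_flow_smult)
  then have "(\<lambda>t. c *s Y t) = frac_flow \<alpha> B (c *s Y 0)" by (rule ext)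
  then show ?thesis using complex_frac_solution_flow by metis
qed

text \<open>Stability concerns only real solutions starting near 0. Multiplying \<open>Y\<close> by
  a scalar of modulus \<open>s\<close> and taking real parts produces such solutions; the scalars
  \<open>s\<close> and \<open>- \<i> * s\<close> recover the real and imaginary parts of
  \<open>Y\<close>.\<close>

lemma solution_tendsto_0_if_stable:
  assumes stable: "zero_asymptotically_stable \<alpha> A"
    and Y: "complex_frac_solution \<alpha> (cmat (A - mat 1)) Y"
  shows "Y \<longlonglongrightarrow> 0"
proof -
  obtain \<delta> where \<delta>: "\<delta> > 0" "\<And>X. is_frac_solution \<alpha> A X \<Longrightarrow> norm (X 0) < \<delta> \<Longrightarrow> X \<longlonglongrightarrow> 0"
    using stable unfolding zero_asymptotically_stable_def by blast
  \<comment> \<open>The summand 1 avoids division by 0 when \<open>Y 0 = 0\<close> and makes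
    \<open>s * norm (Y 0) < \<delta>\<close> strict.\<close>
  define s where "s = \<delta> / (norm (Y 0) + 1)"
  have pos: "0 < norm (Y 0) + 1" by (intro add_nonneg_pos) auto
  then have "s * (norm (Y 0) + 1) = \<delta>" and s1: "0 < s" using \<delta>(1) by (simp_all add: s_def)
  then have s: "0 < s" "s * norm (Y 0) < \<delta>" by (simp_all add: algebra_simps)
  have part: "(\<lambda>t. Re (c * Y t $ i)) \<longlonglongrightarrow> 0" if "norm c = s" for c i
  proof -
    have "(\<lambda>t. Re_vec (c *s Y t)) \<longlonglongrightarrow> 0"
    proof (rule \<delta>(2))
      show "is_frac_solution \<alpha> A (\<lambda>t. Re_vec (c *s Y t))"
        by (rule Re_vec_solution[OF complex_frac_solution_smult[OF Y]])
      have "norm (Re_vec (c *s Y 0)) \<le> s * norm (Y 0)"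
        using norm_Re_vec_le[of "c *s Y 0"] that by (simp add: norm_vec_smult)
      then show "norm (Re_vec (c *s Y 0)) < \<delta>" using s by simp
    qed
    from tendsto_vec_nth[OF this, of i] show ?thesis by (simp add: Re_vec_def)
  qed
  show ?thesis
  proof (rule vec_tendstoI)
    fix i
    have "(\<lambda>t. Complex (Re (of_real s * Y t $ i)) (Re (- \<i> * of_real s * Y t $ i))) \<longlonglongrightarrow> Complex 0 0"
      using s(1) by (intro tendsto_Complex part) (auto simp: norm_mult)
    moreover have "Complex (Re (of_real s * Y t $ i)) (Re (- \<i> * of_real s * Y t $ i)) = of_real s * Y t $ i" for t
      by (simp add: complex_eq_iff)
    ultimately have "(\<lambda>t. of_real s * Y t $ i) \<longlonglongrightarrow> 0" by (simp add: zero_complex.code)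
    then have "(\<lambda>t. inverse (of_real s) * (of_real s * Y t $ i)) \<longlonglongrightarrow> inverse (of_real s) * 0"
      by (intro tendsto_intros)
    then show "(\<lambda>t. Y t $ i) \<longlonglongrightarrow> 0 $ i" using s(1) by (simp add: mult.assoc[symmetric])
  qed
qed

text \<open>Each of the finitely many flows from basis vectors converges and is therefore bounded;
  linearity extends the bound to all \<open>v\<close>, uniformly in \<open>t\<close>.\<close>

lemma frac_flow_bounded:
  assumes "\<And>v. frac_flow \<alpha> B v \<longlonglongrightarrow> 0"
  obtains K where "0 < K" "\<And>v t. norm (frac_flow \<alpha> B v t) \<le> K * norm v"
proof -
  have "\<exists>K. \<forall>t. norm (frac_flow \<alpha> B (axis i 1) t) \<le> K" for i
    using convergent_imp_Bseq[OF convergentI[OF assms]] by (auto simp: Bseq_def)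
  then obtain K where K: "\<And>i t. norm (frac_flow \<alpha> B (axis i 1) t) \<le> K i" by metis
  have K0: "0 \<le> K i" for i using order_trans[OF norm_ge_zero K] .
  show thesis
  \<comment> \<open>Adding 1 makes the constant strictly positive, so that it can later serve as a
    divisor.\<close>
  proof (rule that[of "sum K UNIV + 1"])
    show "0 < sum K UNIV + 1" using K0 by (intro add_nonneg_pos sum_nonneg) auto
    fix v :: "complex^'a" and t
    have "v = (\<Sum>i\<in>UNIV. v $ i *s axis i 1)"
      by (simp add: vec_eq_iff axis_def if_distrib cong: if_cong)
    then have "norm (frac_flow \<alpha> B v t) = norm (\<Sum>i\<in>UNIV. v $ i *s frac_flow \<alpha> B (axis i 1) t)"
      by (metis (no_types, lifting) frac_flow_sum frac_flow_smult sum.cong)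
    also have "\<dots> \<le> (\<Sum>i\<in>UNIV. norm v * K i)"
      by (intro sum_norm_le) (auto simp: norm_vec_smult intro!: mult_mono K Finite_Cartesian_Product.norm_nth_le)
    also have "\<dots> \<le> (sum K UNIV + 1) * norm v"
      by (simp add: sum_distrib_left algebra_simps)
    finally show "norm (frac_flow \<alpha> B v t) \<le> (sum K UNIV + 1) * norm v" .
  qed
qed

text \<open>For this linear system attraction implies Lyapunov stability through the uniform bound
  \<open>K\<close>. Since \<open>complex_vec\<close> preserves norms, estimates for the complex flow
  apply to real solutions.\<close>

lemma stable_if_frac_flow_tendsto_0:
  assumes "\<And>v. frac_flow \<alpha> (cmat (A - mat 1)) v \<longlonglongrightarrow> 0"
  shows "zero_asymptotically_stable \<alpha> A"
proof -
  let ?U = "frac_flow \<alpha> (cmat (A - mat 1))"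
  obtain K where K: "0 < K" "\<And>v t. norm (?U v t) \<le> K * norm v"
    using frac_flow_bounded[OF assms] by blast
  have X: "norm (X t) = norm (?U (complex_vec (X 0)) t)" if "is_frac_solution \<alpha> A X" for X t
    using complex_frac_solution_eq_flow[OF complex_vec_solution[OF that], of t] by (metis norm_complex_vec)
  show ?thesis
    unfolding zero_asymptotically_stable_def
  proof (intro conjI allI impI)
    fix \<epsilon> :: real assume \<epsilon>: "0 < \<epsilon>"
    show "\<exists>\<delta>>0. \<forall>X. is_frac_solution \<alpha> A X \<and> norm (X 0) < \<delta> \<longrightarrow> (\<forall>t. norm (X t) < \<epsilon>)"
    proof (intro exI[of _ "\<epsilon> / K"] conjI allI impI)
      fix X t assume *: "is_frac_solution \<alpha> A X \<and> norm (X 0) < \<epsilon> / K"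
      then have "norm (X t) \<le> K * norm (X 0)"
        using K(2)[of "complex_vec (X 0)" t] X[of X t] by (simp add: norm_complex_vec)
      also have "\<dots> < \<epsilon>" using * K(1) by (simp add: field_simps)
      finally show "norm (X t) < \<epsilon>" .
    qed (use \<epsilon> K in auto)
  next
    show "\<exists>\<delta>>0. \<forall>X. is_frac_solution \<alpha> A X \<and> norm (X 0) < \<delta> \<longrightarrow> X \<longlonglongrightarrow> 0"
    proof (intro exI[of _ 1] conjI allI impI)
      fix X assume "is_frac_solution \<alpha> A X \<and> norm (X 0) < 1"
      then have "(\<lambda>t. norm (X t)) \<longlonglongrightarrow> 0"
        using tendsto_norm_zero[OF assms[of "complex_vec (X 0)"]] X[of X] by simp
      then show "X \<longlonglongrightarrow> 0" by (rule tendsto_norm_zero_cancel)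
    qed simp
  qed
qed

theorem theorem1:
  fixes A :: "real^'n^'n" and \<alpha> :: real
  assumes "0 < \<alpha>" and "\<alpha> < 1"
  shows "zero_asymptotically_stable \<alpha> A \<longleftrightarrow> (\<forall>z. 1 \<le> cmod z \<longrightarrow> char_fun \<alpha> A z \<noteq> 0)"
  unfolding char_fun_nonzero_iff_symbol_nonzero[OF assms]
proof
  let ?B = "cmat (A - mat 1)"
  assume stable: "zero_asymptotically_stable \<alpha> A"
  show "\<forall>\<mu> w. det (mat \<mu> - ?B) = 0 \<longrightarrow> norm w \<le> 1 \<longrightarrow> eval_fps (symbol_fps \<alpha> \<mu>) w \<noteq> 0"
  proof (intro allI impI notI)
    fix \<mu> w
    assume "det (mat \<mu> - ?B) = 0" and w: "norm w \<le> 1" and root: "eval_fps (symbol_fps \<alpha> \<mu>) w = 0"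
    then obtain v where v: "(mat \<mu> - ?B) *v v = 0" "v \<noteq> 0"
      using invertible_det_nz invertible_left_inverse matrix_left_invertible_ker by metis
    then have Bv: "?B *v v = \<mu> *s v" by (simp add: matrix_mat_diff_mult)
    \<comment> \<open>A nonzero coordinate of the eigenvector isolates the scalar sequence from the
      vector solution.\<close>
    obtain i where i: "v $ i \<noteq> 0" using v by (auto simp: vec_eq_iff)
    have "(\<lambda>t. fps_nth (scalar_solution \<alpha> \<mu>) t *s v) \<longlonglongrightarrow> 0"
      by (rule solution_tendsto_0_if_stable[OF stable complex_frac_solution_eigenvector[OF assms(1) Bv]])
    from tendsto_vec_nth[OF this, of i]
    have "(\<lambda>t. fps_nth (scalar_solution \<alpha> \<mu>) t * v $ i) \<longlonglongrightarrow> 0" by simp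
    from tendsto_divide[OF this tendsto_const i] i
    have "fps_nth (scalar_solution \<alpha> \<mu>) \<longlonglongrightarrow> 0" by simp
    with scalar_solution_not_tendsto_0[OF assms w root] show False ..
  qed
next
  assume "\<forall>\<mu> w. det (mat \<mu> - cmat (A - mat 1)) = 0 \<longrightarrow> norm w \<le> 1 \<longrightarrow> eval_fps (symbol_fps \<alpha> \<mu>) w \<noteq> 0"
  then show "zero_asymptotically_stable \<alpha> A"
    by (intro stable_if_frac_flow_tendsto_0 frac_flow_tendsto_0 assms) auto
qed

end
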